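(* Let $X,Y$ be real random variables with finite expectations. Then $X\ge_{1\text{-}PD}Y$ if and only if $X\ge_1 Y$.
   Context: For a real random variable $X$, $F_X$ denotes its cumulative distribution function. First-order stochastic dominance: $X\ge_1 Y$ iff $F_X(t)\le F_Y(t)$ for all $t\in\mathbb R$. Power-distorted stochastic dominance: for $k>0$ let $H_k(t)=t^k$, $t\in[0,1]$. Write $X\ge_{H_k}Y$ iff $$\int_{-\infty}^x F_X(t)^k\,dt\le\int_{-\infty}^x F_Y(t)^k\,dt\quad\text{for all }x\in\mathbb R$$ (integrals of non-negative functions, with values in $[0,\infty]$). Write $X\ge_{1\text{-}PD}Y$ iff $X\ge_{H_k}Y$ for all $k>0$. *)

theory Defs
  imports "HOL-Probability.Probability"
begin

definition rv_cdf :: "'a measure \<Rightarrow> ('a \<Rightarrow> real) \<Rightarrow> real \<Rightarrow> real" where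
  "rv_cdf M X = cdf (distr M borel X)"

text \<open>The dominance relations depend only on the laws of the random variables, so the two
  variables may live on different probability spaces \<open>M\<close> and \<open>N\<close>.\<close>

definition fsd :: "'a measure \<Rightarrow> ('a \<Rightarrow> real) \<Rightarrow> 'b measure \<Rightarrow> ('b \<Rightarrow> real) \<Rightarrow> bool" where
  "fsd M X N Y \<longleftrightarrow> (\<forall>t. rv_cdf M X t \<le> rv_cdf N Y t)"

text \<open>The distortion is only ever applied to values in \<open>[0, 1]\<close>; since \<open>0 powr k = 0\<close>, it is the
  usual power \<open>t\<^sup>k\<close> there for every real \<open>k > 0\<close>.\<close>

definition power_distortion :: "real \<Rightarrow> real \<Rightarrow> real" where
  "power_distortion k t = t powr k"

text \<open>The integrals are nonnegative Lebesgue integrals with values in \<open>[0, \<infinity>]\<close>.\<close>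

definition distorted_sd ::
    "(real \<Rightarrow> real) \<Rightarrow> 'a measure \<Rightarrow> ('a \<Rightarrow> real) \<Rightarrow> 'b measure \<Rightarrow> ('b \<Rightarrow> real) \<Rightarrow> bool" where
  "distorted_sd H M X N Y \<longleftrightarrow>
     (\<forall>x. (\<integral>\<^sup>+ t\<in>{..x}. ennreal (H (rv_cdf M X t)) \<partial>lborel)
        \<le> (\<integral>\<^sup>+ t\<in>{..x}. ennreal (H (rv_cdf N Y t)) \<partial>lborel))"

definition pd1 :: "'a measure \<Rightarrow> ('a \<Rightarrow> real) \<Rightarrow> 'b measure \<Rightarrow> ('b \<Rightarrow> real) \<Rightarrow> bool" where
  "pd1 M X N Y \<longleftrightarrow> (\<forall>k>0. distorted_sd (power_distortion k) M X N Y)"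

end

theory Submission
  imports Defs
begin

text \<open>
  If \<open>F s > G s\<close>, right-continuity of \<open>G\<close> gives \<open>0 < b < F s\<close> and \<open>\<delta> > 0\<close> with \<open>G \<le> b\<close> on
  \<open>(-\<infinity>, s + \<delta>]\<close>. There the integral of \<open>F\<^sup>k\<close> is at least \<open>\<delta> (F s)\<^sup>k\<close>, while that of \<open>G\<^sup>k\<close> is at
  most \<open>C b\<^bsup>k-1\<^esup>\<close>, where \<open>C = \<integral> G\<close> is finite because \<open>Y\<close> is integrable. For large \<open>k\<close> this
  contradicts the dominance.
\<close>

context real_distribution
begin

lemma borel_measurable_cdf [measurable]: "cdf M \<in> borel_measurable borel"
  by (rule borel_measurable_mono) (auto intro!: monoI cdf_nondecreasing)

text \<open>Tonelli: \<open>cdf M t\<close> is the mass of {..t}, so exchanging the integrals leaves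
  the length of {y..x}. For x < y this interval is empty, matching \<open>ennreal\<close>, which
  sends negative reals to 0; the right side is thus the mean of the positive part of x - y.\<close>

lemma nn_integral_cdf_atMost:
  "(\<integral>\<^sup>+ t\<in>{..x}. ennreal (cdf M t) \<partial>lborel) = (\<integral>\<^sup>+ y. ennreal (x - y) \<partial>M)"
proof -
  interpret L: pair_sigma_finite lborel M ..
  have "(\<integral>\<^sup>+ t\<in>{..x}. ennreal (cdf M t) \<partial>lborel)
      = (\<integral>\<^sup>+ t. (\<integral>\<^sup>+ y. indicator {..t} y * indicator {..x} t \<partial>M) \<partial>lborel)"
    by (intro nn_integral_cong) (simp add: nn_integral_multc cdf_def emeasure_eq_measure)
  also have "\<dots> = (\<integral>\<^sup>+ t. (\<integral>\<^sup>+ y. (if t \<le> x \<and> y \<le> t then 1 else 0) \<partial>M) \<partial>lborel)"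
    by (intro nn_integral_cong) (auto simp: indicator_def intro!: nn_integral_cong)
  also have "\<dots> = (\<integral>\<^sup>+ y. (\<integral>\<^sup>+ t. (if t \<le> x \<and> y \<le> t then 1 else 0) \<partial>lborel) \<partial>M)"
    by (rule L.Fubini'[symmetric]) measurable
  also have "\<dots> = (\<integral>\<^sup>+ y. (\<integral>\<^sup>+ t. indicator {y..x} t \<partial>lborel) \<partial>M)"
    by (intro nn_integral_cong) (auto simp: indicator_def)
  also have "\<dots> = (\<integral>\<^sup>+ y. ennreal (x - y) \<partial>M)"
    by (intro nn_integral_cong) (auto simp: ennreal_neg emeasure_lborel_Icc_eq)
  finally show ?thesis .
qed

text \<open>The positive part of x - y is at most its absolute value, which is integrable on a
  probability space.\<close>

lemma nn_integral_cdf_atMost_finite: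
  assumes "integrable M (\<lambda>y. y)"
  shows "(\<integral>\<^sup>+ t\<in>{..x}. ennreal (cdf M t) \<partial>lborel) < \<infinity>"
proof -
  have "integrable M (\<lambda>y. x - y)"
    using assms by simp
  then have "(\<integral>\<^sup>+ y. ennreal (norm (x - y)) \<partial>M) < \<infinity>"
    by (simp add: integrable_iff_bounded)
  moreover have "(\<integral>\<^sup>+ y. ennreal (x - y) \<partial>M) \<le> (\<integral>\<^sup>+ y. ennreal (norm (x - y)) \<partial>M)"
    by (intro nn_integral_mono ennreal_leI) simp
  ultimately show ?thesis
    unfolding nn_integral_cdf_atMost by order
qed

end

text \<open>Natural exponents suffice, because the contradiction only needs arbitrarily large
  ones.\<close>

lemma cdf_le_if_power_dominated:
  assumes "real_distribution P" "real_distribution Q" "integrable Q (\<lambda>y. y)"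
    and dom: "\<And>n x. 0 < n \<Longrightarrow>
      (\<integral>\<^sup>+ t\<in>{..x}. ennreal (cdf P t ^ n) \<partial>lborel) \<le> (\<integral>\<^sup>+ t\<in>{..x}. ennreal (cdf Q t ^ n) \<partial>lborel)"
  shows "cdf P s \<le> cdf Q s"
proof (rule ccontr)
  interpret P: real_distribution P by fact
  interpret Q: real_distribution Q by fact
  assume "\<not> cdf P s \<le> cdf Q s"
  then obtain b where b: "cdf Q s < b" "b < cdf P s"
    using dense[of "cdf Q s" "cdf P s"] by auto
  define a where "a = cdf P s"
  have "0 < b"
    using b(1) Q.cdf_nonneg[of s] by linarith
  have "eventually (\<lambda>t. cdf Q t < b) (at_right s)"
    using Q.cdf_is_right_cont[of s] b(1)
    by (auto simp: continuous_within intro: order_tendstoD)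
  then obtain u where u: "s < u" "\<And>t. s < t \<Longrightarrow> t < u \<Longrightarrow> cdf Q t < b"
    unfolding eventually_at_right_field by auto
  \<comment> \<open>Any point strictly between s and u would do; v - s is the length of the interval
    on which \<open>cdf P\<close> is bounded below.\<close>
  define v where "v = (s + u) / 2"
  have v: "s < v" "cdf Q v < b"
    using u by (auto simp: v_def)
  have Qb: "cdf Q t \<le> b" if "t \<le> v" for t
    using Q.cdf_nondecreasing[OF that] v(2) by linarith
  obtain C where C: "(\<integral>\<^sup>+ t\<in>{..v}. ennreal (cdf Q t) \<partial>lborel) = ennreal C" "0 \<le> C"
    using Q.nn_integral_cdf_atMost_finite[OF assms(3), of v]
    by (cases "\<integral>\<^sup>+ t\<in>{..v}. ennreal (cdf Q t) \<partial>lborel") auto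
  \<comment> \<open>Below, restrict to {s..v}, where \<open>cdf P\<close> is at least a. Above,
    bound only n of the \<open>Suc n\<close> factors by b: the remaining factor \<open>cdf Q\<close>
    keeps the integral over the unbounded half-line finite.\<close>
  have bound: "a ^ Suc n * (v - s) \<le> C * b ^ n" for n
  proof -
    have "ennreal (a ^ Suc n * (v - s)) = (\<integral>\<^sup>+ t. ennreal (a ^ Suc n) * indicator {s..v} t \<partial>lborel)"
      using v(1) by (simp add: a_def ennreal_mult P.cdf_nonneg nn_integral_cmult_indicator del: power_Suc)
    also have "\<dots> \<le> (\<integral>\<^sup>+ t\<in>{..v}. ennreal (cdf P t ^ Suc n) \<partial>lborel)"
      unfolding a_def
      by (intro nn_integral_mono)
        (auto simp: indicator_def simp del: power_Suc
          intro!: ennreal_leI power_mono P.cdf_nondecreasing P.cdf_nonneg)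
    also have "\<dots> \<le> (\<integral>\<^sup>+ t\<in>{..v}. ennreal (cdf Q t ^ Suc n) \<partial>lborel)"
      by (rule dom) simp
    also have "\<dots> \<le> (\<integral>\<^sup>+ t. ennreal (b ^ n) * (ennreal (cdf Q t) * indicator {..v} t) \<partial>lborel)"
    proof (intro nn_integral_mono)
      fix t
      have "cdf Q t ^ Suc n \<le> b ^ n * cdf Q t" if "t \<le> v"
        using Qb[OF that] Q.cdf_nonneg[of t]
        by (auto simp: mult.commute intro!: mult_left_mono power_mono)
      then show "ennreal (cdf Q t ^ Suc n) * indicator {..v} t
          \<le> ennreal (b ^ n) * (ennreal (cdf Q t) * indicator {..v} t)"
        using \<open>0 < b\<close> Q.cdf_nonneg[of t]
        by (auto simp: indicator_def ennreal_mult[symmetric] simp del: power_Suc intro!: ennreal_leI)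
    qed
    also have "\<dots> = ennreal (b ^ n) * ennreal C"
      by (simp add: nn_integral_cmult C(1))
    also have "\<dots> = ennreal (C * b ^ n)"
      using \<open>0 < b\<close> C(2) by (simp add: ennreal_mult mult.commute)
    finally show ?thesis
      using \<open>0 < b\<close> C(2) by (simp add: ennreal_le_iff del: power_Suc)
  qed
  have a: "b < a"
    using b(2) by (simp add: a_def)
  with \<open>0 < b\<close> have "1 < a / b" "0 < (v - s) * a"
    \<comment> \<open>Dividing \<open>bound\<close> by b^n and (v - s) * a would bound all powers of
      a / b by one constant, which is impossible as a / b > 1.\<close>
    using v(1) by auto
  then obtain n where n: "C / ((v - s) * a) < (a / b) ^ n"
    using real_arch_pow by blast
  then have "C * b ^ n < a ^ Suc n * (v - s)"
    using \<open>0 < (v - s) * a\<close> \<open>0 < b\<close> v(1) a by (simp add: field_simps)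
  with bound[of n] show False
    by simp
qed

theorem theorem2:
  fixes M :: "'a measure" and N :: "'b measure"
    and X :: "'a \<Rightarrow> real" and Y :: "'b \<Rightarrow> real"
  assumes "prob_space M" and "prob_space N"
    and "X \<in> borel_measurable M" and "Y \<in> borel_measurable N"
    and "integrable M X" and "integrable N Y"
  shows "pd1 M X N Y \<longleftrightarrow> fsd M X N Y"
proof
  interpret P: real_distribution "distr M borel X"
    using assms by (simp add: prob_space.real_distribution_distr)
  assume "fsd M X N Y"
  then show "pd1 M X N Y"
    unfolding pd1_def distorted_sd_def fsd_def power_distortion_def rv_cdf_def
    \<comment> \<open>The inequality already holds pointwise, since z powr k is increasing in z
      \<ge> 0 for k > 0.\<close>
    by (intro allI impI nn_integral_mono mult_right_mono ennreal_leI powr_mono2 P.cdf_nonneg) auto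
next
  interpret P: real_distribution "distr M borel X"
    using assms by (simp add: prob_space.real_distribution_distr)
  interpret Q: real_distribution "distr N borel Y"
    using assms by (simp add: prob_space.real_distribution_distr)
  have int: "integrable (distr N borel Y) (\<lambda>y. y)"
    using assms by (simp add: integrable_distr_eq)
  \<comment> \<open>Positivity of n matters at z = 0, where \<open>0 powr 0 = 0\<close> but
    \<open>0 ^ 0 = 1\<close>; a cdf may well vanish.\<close>
  have powr_nat: "z powr real n = z ^ n" if "0 \<le> z" "0 < n" for z :: real and n
    using that by (simp add: powr_realpow')
  assume pd: "pd1 M X N Y"
  have "(\<integral>\<^sup>+ t\<in>{..x}. ennreal (cdf (distr M borel X) t ^ n) \<partial>lborel)
      \<le> (\<integral>\<^sup>+ t\<in>{..x}. ennreal (cdf (distr N borel Y) t ^ n) \<partial>lborel)" if "0 < n" for n x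
    using pd[unfolded pd1_def distorted_sd_def power_distortion_def rv_cdf_def,
        rule_format, of "real n" x] that
    by (simp add: powr_nat P.cdf_nonneg Q.cdf_nonneg)
  then show "fsd M X N Y"
    unfolding fsd_def rv_cdf_def
    using cdf_le_if_power_dominated P.real_distribution_axioms Q.real_distribution_axioms int
    by blast
qed

end
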